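(* Let $\ell_1,\dots,\ell_n:\mathbb{R}^d\to\mathbb{R}$ be continuously differentiable functions whose gradients are $L$-Lipschitz continuous ($L>0$), with $\inf_{x\in\mathbb{R}^d}\ell_i(x)>-\infty$ for every $i$. Let $f:=\frac1n\sum_{i=1}^n\ell_i$, let $\mathcal{X}_i^*$ be the set of global minimizers of $\ell_i$, and assume that $\mathcal{X}^*:=\bigcap_{i=1}^n\mathcal{X}_i^*$ is non-empty and bounded. Let $0<\eta<\frac1L$, and let $\{x_k\}_{k\ge 0}$ be the sequence generated from an initial point $x_0\in\mathbb{R}^d$ by SGD with learning rate $\eta$ and cyclic sampling with reshuffle, with sampled indices $\xi_k$. Assume that SGD follows an iterationwise star-convex path, i.e. for all $k=0,1,2,\dots$ and for every $x^*\in\mathcal{X}_{\xi_k}^*$, $$\ell_{\xi_k}(x_k)-\ell_{\xi_k}(x^* )+\langle x^*-x_k,\nabla\ell_{\xi_k}(x_k)\rangle\le 0 .$$ Then the sequence $\{x_k\}_{k\ge 0}$ converges to a global minimizer of $f$.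
   Context: The underlying problem is $\min_{x\in\mathbb{R}^d} f(x)$. $\langle\cdot,\cdot\rangle$ is the Euclidean inner product. SGD with cyclic sampling with reshuffle: for each epoch $B=0,1,2,\dots$, $\pi_B$ is a (randomly drawn) permutation of $\{1,\dots,n\}$. Every iteration index is written $k=nB+t$ with $B\ge 0$ and $t\in\{0,\dots,n-1\}$, the sampled index is $\xi_k=\pi_B(t+1)$, and the update is $x_{k+1}=x_k-\eta\nabla\ell_{\xi_k}(x_k)$ for $k=0,1,2,\dots$. The hypothesis and the conclusion both concern the realized path, for the realized sequence of permutations. *)

theory Defs
  imports "HOL-Analysis.Analysis"
begin

text \<open>The gradient is specified through the library predicate \<open>GDERIV\<close>; it is meaningful at points
  of differentiability only.\<close>

definition gradient :: "('a::real_inner \<Rightarrow> real) \<Rightarrow> 'a \<Rightarrow> 'a" where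
  "gradient g x = (THE D. GDERIV g x :> D)"

lemma gradient_eqI:
  fixes g :: "'a::real_inner \<Rightarrow> real"
  assumes "GDERIV g x :> D"
  shows "gradient g x = D"
  unfolding gradient_def
proof (rule the_equality)
  fix D' assume "GDERIV g x :> D'"
  with assms have "(\<lambda>h. h \<bullet> D') = (\<lambda>h. h \<bullet> D)"
    unfolding gderiv_def by (rule has_derivative_unique[rotated])
  then have "h \<bullet> (D' - D) = 0" for h
    by (simp add: inner_diff_right fun_eq_iff)
  then show "D' = D" by (metis inner_eq_zero_iff right_minus_eq)
qed (rule assms)

lemma GDERIV_gradient:
  fixes g :: "'a::euclidean_space \<Rightarrow> real"
  assumes "g differentiable (at x)"
  shows "GDERIV g x :> gradient g x"
proof -
  from assms obtain g' where g': "(g has_derivative g') (at x)"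
    by (auto simp: differentiable_def)
  then interpret linear g' by (rule has_derivative_linear)
  have "g' = (\<lambda>h. h \<bullet> adjoint g' 1)"
    using adjoint_works[OF linear_axioms, of _ 1] by (auto simp: fun_eq_iff)
  with g' have "GDERIV g x :> adjoint g' 1" by (simp add: gderiv_def)
  then show ?thesis by (simp add: gradient_eqI)
qed

definition continuously_differentiable :: "('a::real_inner \<Rightarrow> real) \<Rightarrow> bool" where
  "continuously_differentiable g \<longleftrightarrow>
     (\<forall>x. g differentiable (at x)) \<and> continuous_on UNIV (gradient g)"

definition global_minimizers :: "('a \<Rightarrow> real) \<Rightarrow> 'a set" where
  "global_minimizers g = {x. is_arg_min g (\<lambda>_. True) x}"

text \<open>Losses are indexed from 1. Epoch \<open>k div n\<close> uses the permutation \<open>\<pi> (k div n)\<close> of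
  \<open>{1..n}\<close>, and \<open>k mod n\<close> is the position within the epoch, counted from 0.\<close>

definition reshuffle_index :: "nat \<Rightarrow> (nat \<Rightarrow> nat \<Rightarrow> nat) \<Rightarrow> nat \<Rightarrow> nat" where
  "reshuffle_index n \<pi> k = \<pi> (k div n) (k mod n + 1)"

primrec sgd_iterate ::
  "(nat \<Rightarrow> 'a::real_inner \<Rightarrow> real) \<Rightarrow> real \<Rightarrow> (nat \<Rightarrow> nat) \<Rightarrow> 'a \<Rightarrow> nat \<Rightarrow> 'a" where
  "sgd_iterate l \<eta> \<xi> x0 0 = x0"
| "sgd_iterate l \<eta> \<xi> x0 (Suc k) =
     sgd_iterate l \<eta> \<xi> x0 k - \<eta> *\<^sub>R gradient (l (\<xi> k)) (sgd_iterate l \<eta> \<xi> x0 k)"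

definition iterationwise_star_convex_path ::
  "(nat \<Rightarrow> 'a::real_inner \<Rightarrow> real) \<Rightarrow> (nat \<Rightarrow> nat) \<Rightarrow> (nat \<Rightarrow> 'a) \<Rightarrow> bool" where
  "iterationwise_star_convex_path l \<xi> x \<longleftrightarrow>
     (\<forall>k. \<forall>z \<in> global_minimizers (l (\<xi> k)).
        l (\<xi> k) (x k) - l (\<xi> k) z + (z - x k) \<bullet> gradient (l (\<xi> k)) (x k) \<le> 0)"

end

(* Fix a common minimizer z. Star-convexity along the path and the bound
   |grad l(x)|^2 <= 2 L (l(x) - inf l) give
     |x_{k+1} - z|^2 <= |x_k - z|^2 - 2 eta (1 - eta L) (l_{xi_k}(x_k) - l_{xi_k}(z)),
   so the distances to z decrease and the gaps l_{xi_k}(x_k) - l_{xi_k}(z) tend to 0; hence so do the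
   gradients and the increments of x. Within an epoch the path therefore moves by o(1) while every
   index i is sampled, so a limit point of the epoch starting points minimizes every l_i. The distance
   to this limit point decreases as well, and the whole sequence converges to it. *)
theory Submission
  imports Defs
begin

lemma global_minimizers_iff:
  fixes g :: "'a \<Rightarrow> real"
  shows "z \<in> global_minimizers g \<longleftrightarrow> (\<forall>y. g z \<le> g y)"
  by (auto simp: global_minimizers_def is_arg_min_linorder)

text \<open>Subtracting the quadratic model from \<open>g\<close> along the segment from
  \<open>x\<close> to \<open>x + d\<close> leaves \<open>\<phi>\<close>. Cauchy-Schwarz and the
  Lipschitz bound let the directional derivative of \<open>g\<close> grow by at most
  \<open>L * t * (norm d)\<^sup>2\<close> up to time \<open>t\<close>, so \<open>\<phi>\<close> does
  not increase on [0, 1].\<close>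

lemma lipschitz_gradient_descent:
  fixes g :: "'a::euclidean_space \<Rightarrow> real"
  assumes diff: "\<And>y. g differentiable (at y)"
    and lip: "L-lipschitz_on UNIV (gradient g)"
  shows "g (x + d) \<le> g x + d \<bullet> gradient g x + L / 2 * (norm d)\<^sup>2"
proof -
  define \<phi> where "\<phi> = (\<lambda>t. g (x + t *\<^sub>R d) - t * (d \<bullet> gradient g x) - L / 2 * t\<^sup>2 * (norm d)\<^sup>2)"
  have "\<phi> 1 \<le> \<phi> 0"
  proof (rule DERIV_nonpos_imp_nonincreasing[of 0 1 \<phi>])
    fix t :: real
    assume "0 \<le> t" "t \<le> 1"
    let ?D = "d \<bullet> gradient g (x + t *\<^sub>R d) - d \<bullet> gradient g x - L * t * (norm d)\<^sup>2"
    have g': "(g has_derivative (\<lambda>h. h \<bullet> gradient g (x + t *\<^sub>R d))) (at (x + t *\<^sub>R d))"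
      using GDERIV_gradient[OF diff] by (simp add: gderiv_def)
    have "((\<lambda>s. x + s *\<^sub>R d) has_derivative (\<lambda>s. s *\<^sub>R d)) (at t)"
      by (auto intro!: derivative_eq_intros)
    from has_derivative_compose[OF this g']
    have "((\<lambda>s. g (x + s *\<^sub>R d)) has_real_derivative d \<bullet> gradient g (x + t *\<^sub>R d)) (at t)"
      by (simp add: has_field_derivative_def mult.commute[of _ "d \<bullet> _"] fun_eq_iff)
    then have "DERIV \<phi> t :> ?D"
      unfolding \<phi>_def by (auto intro!: derivative_eq_intros)
    moreover have "?D \<le> 0"
    proof -
      have "d \<bullet> (gradient g (x + t *\<^sub>R d) - gradient g x)
          \<le> norm d * norm (gradient g (x + t *\<^sub>R d) - gradient g x)"
        by (rule norm_cauchy_schwarz)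
      also have "\<dots> \<le> norm d * (L * (t * norm d))"
        using lipschitz_onD[OF lip, of "x + t *\<^sub>R d" x] \<open>0 \<le> t\<close>
        by (intro mult_left_mono) (auto simp: dist_norm)
      finally show ?thesis
        by (simp add: inner_diff_right power2_eq_square algebra_simps)
    qed
    ultimately show "\<exists>D. DERIV \<phi> t :> D \<and> D \<le> 0" by blast
  qed simp
  then show ?thesis by (simp add: \<phi>_def)
qed

text \<open>The displacement \<open>- (1 / L) *\<^sub>R gradient g x\<close> minimizes the quadratic
  upper bound at \<open>x\<close>. It lowers that bound by the squared gradient norm over
  \<open>2 * L\<close>, and no value of \<open>g\<close> lies below \<open>g z\<close>.\<close>

lemma norm_gradient_le_gap:
  fixes g :: "'a::euclidean_space \<Rightarrow> real"
  assumes diff: "\<And>y. g differentiable (at y)"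
    and lip: "L-lipschitz_on UNIV (gradient g)" and "L > 0"
    and z: "z \<in> global_minimizers g"
  shows "(norm (gradient g x))\<^sup>2 \<le> 2 * L * (g x - g z)"
proof -
  let ?G = "gradient g x"
  have "g z \<le> g (x + (- (1 / L)) *\<^sub>R ?G)"
    using z by (simp add: global_minimizers_iff)
  also have "\<dots> \<le> g x + ((- (1 / L)) *\<^sub>R ?G) \<bullet> ?G + L / 2 * (norm ((- (1 / L)) *\<^sub>R ?G))\<^sup>2"
    by (rule lipschitz_gradient_descent[OF diff lip])
  also have "\<dots> = g x - 1 / L * (norm ?G)\<^sup>2 + L / 2 * (1 / L)\<^sup>2 * (norm ?G)\<^sup>2"
    by (simp only: inner_scaleR_left norm_scaleR power_mult_distrib power2_abs power2_minus
        power2_norm_eq_inner mult_minus_left add_uminus_conv_diff mult.assoc)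
  also have "L / 2 * (1 / L)\<^sup>2 = 1 / (2 * L)"
    using \<open>L > 0\<close> by (simp add: power2_eq_square)
  also have "g x - 1 / L * (norm ?G)\<^sup>2 + 1 / (2 * L) * (norm ?G)\<^sup>2 = g x - (norm ?G)\<^sup>2 / (2 * L)"
    by simp
  finally show ?thesis using \<open>L > 0\<close> by (simp add: field_simps)
qed

text \<open>Expand the square: star-convexity turns the cross term into a decrease of
  \<open>2 * \<eta>\<close> times the gap, and the squared gradient gives back at most
  \<open>2 * \<eta>\<^sup>2 * L\<close> times the gap.\<close>

lemma gradient_step_dist_le:
  fixes g :: "'a::euclidean_space \<Rightarrow> real"
  assumes diff: "\<And>y. g differentiable (at y)"
    and lip: "L-lipschitz_on UNIV (gradient g)" and "L > 0" and "\<eta> > 0"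
    and z: "z \<in> global_minimizers g"
    and star: "g x - g z + (z - x) \<bullet> gradient g x \<le> 0"
  shows "(dist (x - \<eta> *\<^sub>R gradient g x) z)\<^sup>2
    \<le> (dist x z)\<^sup>2 - 2 * \<eta> * (1 - \<eta> * L) * (g x - g z)"
proof -
  let ?G = "gradient g x"
  have "(dist (x - \<eta> *\<^sub>R ?G) z)\<^sup>2 = (dist x z)\<^sup>2 + 2 * \<eta> * ((z - x) \<bullet> ?G) + \<eta>\<^sup>2 * (norm ?G)\<^sup>2"
    unfolding dist_norm power2_norm_eq_inner
    by (simp add: inner_diff_left inner_diff_right inner_commute power2_eq_square algebra_simps)
  also have "\<dots> \<le> (dist x z)\<^sup>2 + 2 * \<eta> * (g z - g x) + \<eta>\<^sup>2 * (2 * L * (g x - g z))"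
    using norm_gradient_le_gap[OF diff lip \<open>L > 0\<close> z, of x] star \<open>\<eta> > 0\<close>
    by (intro add_mono mult_left_mono) auto
  also have "\<dots> = (dist x z)\<^sup>2 - 2 * \<eta> * (1 - \<eta> * L) * (g x - g z)"
    by (simp add: algebra_simps power2_eq_square)
  finally show ?thesis .
qed

text \<open>Monotone distances have a limit, and the indices \<open>s j\<close> identify it as
  0.\<close>

lemma tendsto_if_decseq_dist_subseq:
  fixes x :: "nat \<Rightarrow> 'a::metric_space"
  assumes dec: "decseq (\<lambda>k. dist (x k) z)"
    and s: "filterlim s at_top sequentially"
    and lim: "(\<lambda>j. x (s j)) \<longlonglongrightarrow> z"
  shows "x \<longlonglongrightarrow> z"
proof -
  obtain d where d: "(\<lambda>k. dist (x k) z) \<longlonglongrightarrow> d"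
    by (rule decseq_convergent[OF dec, of 0]) auto
  then have "(\<lambda>j. dist (x (s j)) z) \<longlonglongrightarrow> d"
    by (rule filterlim_compose[OF _ s])
  moreover have "(\<lambda>j. dist (x (s j)) z) \<longlonglongrightarrow> 0"
    by (rule tendsto_dist_iff[THEN iffD1, OF lim])
  ultimately have "d = 0" by (rule LIMSEQ_unique)
  with d show ?thesis by (auto intro: tendsto_dist_iff[THEN iffD2])
qed

text \<open>Here the offset \<open>t\<close> is fixed; offsets that vary from epoch to epoch are
  handled in the main proof by summing over all \<open>u < n\<close>.\<close>

lemma tendsto_shift_diff_zero:
  fixes x :: "nat \<Rightarrow> 'a::real_normed_vector"
  assumes "(\<lambda>k. x (Suc k) - x k) \<longlonglongrightarrow> 0"
  shows "(\<lambda>k. x (k + t) - x k) \<longlonglongrightarrow> 0"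
proof (induction t)
  case (Suc t)
  have "(\<lambda>k. (x (Suc (k + t)) - x (k + t)) + (x (k + t) - x k)) \<longlonglongrightarrow> 0 + 0"
    using LIMSEQ_ignore_initial_segment[OF assms, of t] Suc by (intro tendsto_add) auto
  then show ?case by simp
qed simp

lemma reshuffle_index_in_range:
  assumes "n \<ge> 1" and "\<pi> (k div n) permutes {1..n}"
  shows "reshuffle_index n \<pi> k \<in> {1..n}"
proof -
  have "k mod n + 1 \<in> {1..n}" using assms(1) by (simp add: Suc_leI)
  then show ?thesis
    unfolding reshuffle_index_def by (simp only: permutes_in_image[OF assms(2)])
qed

lemma reshuffle_index_hits:
  assumes "\<pi> B permutes {1..n}" and "i \<in> {1..n}"
  obtains t where "t < n" and "reshuffle_index n \<pi> (n * B + t) = i"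
proof -
  from assms obtain j where j: "j \<in> {1..n}" "\<pi> B j = i"
    by (metis imageE permutes_image)
  \<comment> \<open>Positions in an epoch count from 0, arguments of the permutation from 1.\<close>
  then obtain t where t: "j = t + 1" "t < n"
    by (cases j) auto
  then have "reshuffle_index n \<pi> (n * B + t) = i"
    using j by (simp add: reshuffle_index_def)
  with \<open>t < n\<close> show ?thesis by (rule that)
qed

lemma global_minimizers_average:
  fixes l :: "nat \<Rightarrow> 'a \<Rightarrow> real"
  assumes "z \<in> (\<Inter>i\<in>{1..n}. global_minimizers (l i))"
  shows "z \<in> global_minimizers (\<lambda>y. 1 / real n * (\<Sum>i=1..n. l i y))"
  using assms unfolding global_minimizers_iff INT_iff
  by (intro allI mult_left_mono sum_mono) auto

theorem theorem3:
  fixes n :: nat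
    and l :: "nat \<Rightarrow> real ^ 'd \<Rightarrow> real"
    and f :: "real ^ 'd \<Rightarrow> real"
    and L \<eta> :: real
    and \<pi> :: "nat \<Rightarrow> nat \<Rightarrow> nat"
    and \<xi> :: "nat \<Rightarrow> nat"
    and x0 :: "real ^ 'd"
    and x :: "nat \<Rightarrow> real ^ 'd"
  assumes "n \<ge> 1"
    and "L > 0"
    and "\<forall>i\<in>{1..n}. continuously_differentiable (l i)"
    and "\<forall>i\<in>{1..n}. L-lipschitz_on UNIV (gradient (l i))"
    and "\<forall>i\<in>{1..n}. bdd_below (range (l i))"
    and "f = (\<lambda>y. 1 / real n * (\<Sum>i=1..n. l i y))"
    and "(\<Inter>i\<in>{1..n}. global_minimizers (l i)) \<noteq> {}"
    and "bounded (\<Inter>i\<in>{1..n}. global_minimizers (l i))"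
    and "0 < \<eta>" and "\<eta> < 1 / L"
    and "\<forall>B. \<pi> B permutes {1..n}"
    and "\<xi> = reshuffle_index n \<pi>"
    and "x = sgd_iterate l \<eta> \<xi> x0"
    and "iterationwise_star_convex_path l \<xi> x"
  shows "\<exists>z \<in> global_minimizers f. x \<longlonglongrightarrow> z"
proof -
  define C where "C = (\<Inter>i\<in>{1..n}. global_minimizers (l i))"
  have diff: "l i differentiable (at y)" if "i \<in> {1..n}" for i y
    using assms(3) that by (auto simp: continuously_differentiable_def)
  have \<xi>: "\<xi> k \<in> {1..n}" for k
    unfolding assms(12) using assms(1,11) by (blast intro: reshuffle_index_in_range)
  have x_Suc: "x (Suc k) = x k - \<eta> *\<^sub>R gradient (l (\<xi> k)) (x k)" for k
    by (simp add: assms(13))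
  \<comment> \<open>The restriction \<open>\<eta> < 1 / L\<close> makes this coefficient positive,
    so each step has a genuine decrease.\<close>
  define c where "c = 2 * \<eta> * (1 - \<eta> * L)"
  have "c > 0"
    using assms(2,9,10) by (simp add: c_def field_simps)
  have in_C: "z \<in> global_minimizers (l i)" if "z \<in> C" "i \<in> {1..n}" for z i
    using that by (auto simp: C_def)
  have step: "(dist (x (Suc k)) z)\<^sup>2 \<le> (dist (x k) z)\<^sup>2 - c * (l (\<xi> k) (x k) - l (\<xi> k) z)"
    if "z \<in> C" for z k
    unfolding x_Suc c_def using assms(2,4,9,14) \<xi>[of k] in_C[OF that \<xi>, of k]
    by (intro gradient_step_dist_le diff) (auto simp: iterationwise_star_convex_path_def)
  have gap_nonneg: "0 \<le> l (\<xi> k) y - l (\<xi> k) z" if "z \<in> C" for y z k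
    using in_C[OF that \<xi>, of k] by (simp add: global_minimizers_iff)
  have dec: "decseq (\<lambda>k. dist (x k) z)" if "z \<in> C" for z
  proof (rule decseq_SucI)
    fix k
    have "(dist (x (Suc k)) z)\<^sup>2 \<le> (dist (x k) z)\<^sup>2"
      using step[OF that, of k] gap_nonneg[OF that, of k] \<open>c > 0\<close>
      by (smt (verit) mult_nonneg_nonneg)
    then show "dist (x (Suc k)) z \<le> dist (x k) z"
      by (simp add: power2_le_iff_abs_le)
  qed
  obtain w where w: "w \<in> C" using assms(7) by (auto simp: C_def)
  have gap: "(\<lambda>k. l (\<xi> k) (x k) - l (\<xi> k) w) \<longlonglongrightarrow> 0"
  proof -
    obtain d where "(\<lambda>k. dist (x k) w) \<longlonglongrightarrow> d"
      by (rule decseq_convergent[OF dec[OF w], of 0]) auto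
    then have d: "(\<lambda>k. (dist (x k) w)\<^sup>2) \<longlonglongrightarrow> d\<^sup>2" by (rule tendsto_power)
    \<comment> \<open>Squared distances to \<open>w\<close> converge, so their successive
      differences vanish; divided by \<open>c\<close>, these differences dominate the gaps.\<close>
    have "(\<lambda>k. ((dist (x k) w)\<^sup>2 - (dist (x (Suc k)) w)\<^sup>2) / c) \<longlonglongrightarrow> (d\<^sup>2 - d\<^sup>2) / c"
      using \<open>c > 0\<close> by (intro tendsto_intros d LIMSEQ_Suc[OF d]) auto
    then have lim: "(\<lambda>k. ((dist (x k) w)\<^sup>2 - (dist (x (Suc k)) w)\<^sup>2) / c) \<longlonglongrightarrow> 0" by simp
    show ?thesis
    proof (rule tendsto_sandwich[OF _ _ tendsto_const lim])
      show "\<forall>\<^sub>F k in sequentially. l (\<xi> k) (x k) - l (\<xi> k) w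
          \<le> ((dist (x k) w)\<^sup>2 - (dist (x (Suc k)) w)\<^sup>2) / c"
        using step[OF w] \<open>c > 0\<close> by (intro always_eventually allI) (simp add: field_simps)
    qed (use gap_nonneg[OF w] in auto)
  qed
  have incr: "(\<lambda>k. x (Suc k) - x k) \<longlonglongrightarrow> 0"
  proof -
    have "(\<lambda>k. (norm (gradient (l (\<xi> k)) (x k)))\<^sup>2) \<longlonglongrightarrow> 0"
    proof (rule tendsto_sandwich[OF _ _ tendsto_const])
      show "(\<lambda>k. 2 * L * (l (\<xi> k) (x k) - l (\<xi> k) w)) \<longlonglongrightarrow> 0"
        by (rule tendsto_mult_right_zero[OF gap])
      show "\<forall>\<^sub>F k in sequentially. (norm (gradient (l (\<xi> k)) (x k)))\<^sup>2
          \<le> 2 * L * (l (\<xi> k) (x k) - l (\<xi> k) w)"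
        using assms(2,4) \<xi> w
        by (intro always_eventually allI norm_gradient_le_gap diff in_C) auto
    qed simp
    then have "(\<lambda>k. gradient (l (\<xi> k)) (x k)) \<longlonglongrightarrow> 0"
      using tendsto_real_sqrt tendsto_norm_zero_cancel by fastforce
    from tendsto_scaleR[OF tendsto_const[of "- \<eta>"] this] show ?thesis by (simp add: x_Suc)
  qed
  \<comment> \<open>Only epoch starts are used for compactness: every index is then sampled within
    \<open>n\<close> steps after each term of the subsequence.\<close>
  have "bounded (range (\<lambda>B. x (n * B)))"
    using decseqD[OF dec[OF w], of 0]
    by (intro bounded_subset[OF bounded_cball[of w "dist (x 0) w"]]) (auto simp: dist_commute)
  then obtain z r where r: "strict_mono r" and z: "((\<lambda>B. x (n * B)) \<circ> r) \<longlonglongrightarrow> z"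
    by (meson bounded_imp_convergent_subsequence)
  define s where "s j = n * r j" for j
  have s_ge: "j \<le> s j" for j
    using seq_suble[OF r, of j] \<open>n \<ge> 1\<close> by (simp add: s_def le_trans[OF _ mult_le_mono1[of 1 n]])
  then have s: "filterlim s at_top sequentially"
    by (intro filterlim_at_top_mono[OF filterlim_ident]) auto
  have z: "(\<lambda>j. x (s j)) \<longlonglongrightarrow> z" using z by (simp add: o_def s_def)
  have "z \<in> C"
    unfolding C_def
  proof
    fix i
    assume i: "i \<in> {1..n}"
    have "\<exists>t<n. \<xi> (s j + t) = i" for j
      using assms(11) unfolding assms(12) s_def by (blast intro: reshuffle_index_hits[OF _ i])
    \<comment> \<open>The offset at which \<open>i\<close> is sampled depends on \<open>j\<close>,
      since each epoch has its own permutation.\<close>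
    then obtain t where t: "\<And>j. t j < n" "\<And>j. \<xi> (s j + t j) = i" by metis
    have st: "filterlim (\<lambda>j. s j + t j) at_top sequentially"
      using s by (rule filterlim_at_top_mono) auto
    have "(\<lambda>j. x (s j + t j) - x (s j)) \<longlonglongrightarrow> 0"
    proof (rule Lim_null_comparison)
      \<comment> \<open>The finite sum over all offsets bounds the displacement at
        \<open>t j\<close> and tends to 0 term by term.\<close>
      show "\<forall>\<^sub>F j in sequentially. norm (x (s j + t j) - x (s j))
          \<le> (\<Sum>u<n. norm (x (s j + u) - x (s j)))"
        using t by (intro always_eventually allI member_le_sum) auto
      show "(\<lambda>j. \<Sum>u<n. norm (x (s j + u) - x (s j))) \<longlonglongrightarrow> 0"
        using filterlim_compose[OF tendsto_shift_diff_zero[OF incr] s]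
        by (intro tendsto_null_sum tendsto_norm_zero)
    qed
    from tendsto_add[OF this z] have "(\<lambda>j. x (s j + t j)) \<longlonglongrightarrow> z" by simp
    \<comment> \<open>Two limits of the same sequence are compared: continuity of \<open>l i\<close>
      gives \<open>l i z - l i w\<close>, while the sampled index at \<open>s j + t j\<close> is
      \<open>i\<close>, so the vanishing of the sampled gaps gives 0.\<close>
    then have "(\<lambda>j. l i (x (s j + t j)) - l i w) \<longlonglongrightarrow> l i z - l i w"
      by (intro tendsto_diff tendsto_const isCont_tendsto_compose[of z "l i"]
          differentiable_imp_continuous_within diff[OF i])
    moreover have "(\<lambda>j. l i (x (s j + t j)) - l i w) \<longlonglongrightarrow> 0"
      using filterlim_compose[OF gap st] by (simp add: t)
    ultimately have "l i z - l i w = 0" by (rule LIMSEQ_unique)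
    then show "z \<in> global_minimizers (l i)"
      using in_C[OF w i] by (simp add: global_minimizers_iff)
  qed
  \<comment> \<open>Membership in \<open>C\<close> lets \<open>dec\<close> be applied to the limit
    point \<open>z\<close> itself instead of \<open>w\<close>.\<close>
  then have "x \<longlonglongrightarrow> z"
    using tendsto_if_decseq_dist_subseq[OF dec s z] by blast
  moreover have "z \<in> global_minimizers f"
    unfolding assms(6) using \<open>z \<in> C\<close> C_def by (blast intro: global_minimizers_average)
  ultimately show ?thesis by blast
qed

end
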